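(* Let $p$ be a prime. Then $\mathcal{C}_G(\mathbb{Z}_p) = \mathcal{C}(\mathbb{Z}_p)$. Specifically: (1) Let $K_v \in \mathcal{C}_G(\mathbb{Z}_p)$ be the construction sub-object, associated to the vertex $v$ of $G$, of a (restricted) $p$-adic graph-directed construction with data $\mathcal{G} = (G,V,\mathcal{E})$ using edge maps $\phi_e(x) = px + j_e$ with $0 \le j_e \le p-1$. Create a path set from the same data $\mathcal{G} = (G,V,\mathcal{E})$, interpreting the $j_e \in \mathcal{A} = \{0,1,\dots,p-1\}$ as edge labels, and let $Y := i_p(X_{\mathcal{G}}(v))$ be the $p$-adic path set fractal with presentation $Y := (\bar i_p, \mathcal{G}, v)$. Then $Y = K_v$. It follows that $\mathcal{C}_G(\mathbb{Z}_p) \subset \mathcal{C}(\mathbb{Z}_p)$. (2) Let $Y \in \mathcal{C}(\mathbb{Z}_p)$ be any $p$-adic path set fractal. Then it has a standard presentation $Y = (\bar i_p, \mathcal{G}, v)$ with a labeled directed graph $\mathcal{G} = (G,V,\mathcal{E})$ having the additional property that all vertices of the graph $G$ have at least one exit edge. By (1) there is an associated (restricted) $p$-adic graph-directed construction having a sub-object $K_v$ with $Y = K_v$. Thus $\mathcal{C}(\mathbb{Z}_p) \subset \mathcal{C}_G(\mathbb{Z}_p)$.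
   Context: Path sets. Let $\mathcal{A}$ be a finite alphabet and $\mathbb{N}=\{0,1,2,\dots\}$. A pointed labeled graph $(\mathcal{G},v)$ over $\mathcal{A}$ consists of a finite directed graph (loops and multiple edges allowed) whose edges are labeled by elements of $\mathcal{A}$, with a marked vertex $v$. Its path set $X_{\mathcal{G}}(v) \subset \mathcal{A}^{\mathbb{N}}$ is the set of label sequences of all one-sided infinite directed walks in $\mathcal{G}$ starting at $v$. Given a digit assignment map $\bar f_p: \mathcal{A} \to \{0,1,\dots,p-1\}$ (not necessarily injective), let $f_p: \mathcal{A}^{\mathbb{N}} \to \mathbb{Z}_p$, $f_p(a_0a_1a_2\cdots) = \sum_{k\ge 0} \bar f_p(a_k)p^k$. A $p$-adic path set fractal is a set of the form $Y = f_p(X_{\mathcal{G}}(v)) \subset \mathbb{Z}_p$; $(\bar f_p,\mathcal{G},v)$ is called a presentation of $Y$, written $Y := (\bar f_p,\mathcal{G},v)$. $\mathcal{C}(\mathbb{Z}_p)$ denotes the collection of all $p$-adic path set fractals. When $\mathcal{A} = \{0,1,\dots,p-1\}$, $\bar i_p$ denotes the identity digit assignment map and $i_p:\mathcal{A}^{\mathbb{N}}\to\mathbb{Z}_p$ the corresponding map. A presentation is standard if it is injective ($\bar f_p$ is one-to-one), right-resolving (at each vertex of $\mathcal{G}$ all exiting edges have different labels) and reachable (every vertex of $\mathcal{G}$ can be reached by a directed path from $v$). Geometric construction. A (restricted) $p$-adic graph-directed construction has initial sets $J_i = \mathbb{Z}_p$ for $1 \le i \le n$, and its data is a finite directed labeled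 graph $\mathcal{G} = (G,V,\mathcal{E})$ with vertex set $V = \{1,\dots,n\}$, where each edge $e$ has data $(i(e), f(e), j_e)$ consisting of its initial vertex $i(e) \in V$, final vertex $f(e) \in V$ and label $j_e \in \{0,1,\dots,p-1\}$; no two edges have the same data, and each vertex has at least one exit edge. To each edge $e$ is associated the map $\phi_e: \mathbb{Z}_p \to \mathbb{Z}_p$, $\phi_e(y) = py + j_e$. The construction sub-objects are the unique nonempty compact sets $K_i \subseteq \mathbb{Z}_p$ ($i \in V$) satisfying $$K_i = \bigcup_{\{e :\, i(e) = i\}} \phi_e(K_{f(e)}) \quad \text{for each } i \in V.$$ $\mathcal{C}_G(\mathbb{Z}_p)$ denotes the set of all $Y \subseteq \mathbb{Z}_p$ that equal some sub-object $K_i$ of some such construction.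
   Formalization: The empty set, which is a p-adic path set fractal when no infinite walk starts at v but is never a sub-object K_v, is excluded: the equality, part (2) and the inclusion of C(Z_p) in C_G(Z_p) are stated for nonempty path set fractals. *)

theory Defs
  imports
    "HOL-Algebra.Ring"
    "HOL-Analysis.Function_Topology"
    "HOL-Computational_Algebra.Primes"
    "HOL-Library.Countable_Set"
    "Graph_Theory.Digraph"
begin

section \<open>The ring of p-adic integers\<close>

text \<open>
  \<open>\<int>\<^sub>p\<close> is the inverse limit of the rings \<open>\<int> / p\<^sup>n \<int>\<close>; the \<open>n\<close>-th component of an element is
  its residue modulo \<open>p\<^sup>n\<close>, represented in \<open>{0..<p\<^sup>n}\<close>.  The type \<^typ>\<open>nat \<Rightarrow> int\<close> carries the
  product topology of the discrete topology on the integers, so the topology that the carrier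
  inherits from it is the usual \<open>p\<close>-adic one.
\<close>

definition padic_int :: "nat \<Rightarrow> (nat \<Rightarrow> int) ring" where
  "padic_int p =
    \<lparr> carrier = {x. \<forall>n. 0 \<le> x n \<and> x n < int p ^ n \<and> x (Suc n) mod int p ^ n = x n},
      monoid.mult = (\<lambda>x y n. (x n * y n) mod int p ^ n),
      one = (\<lambda>n. 1 mod int p ^ n),
      zero = (\<lambda>n. 0),
      add = (\<lambda>x y n. (x n + y n) mod int p ^ n) \<rparr>"

lemma mod_mod_power_Suc: "(a mod (int p * int p ^ n)) mod int p ^ n = a mod int p ^ n"
  by (simp add: mod_mod_cancel)

lemma padic_int_mod_id:
  "x \<in> carrier (padic_int p) \<Longrightarrow> x n mod int p ^ n = x n"
  by (simp add: padic_int_def)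

lemma cring_padic_int:
  assumes "p > 0"
  shows "cring (padic_int p)"
proof (rule cringI)
  show "abelian_group (padic_int p)"
  proof (rule abelian_groupI)
    fix x y assume xy: "x \<in> carrier (padic_int p)" "y \<in> carrier (padic_int p)"
    have "(x (Suc n) + y (Suc n)) mod int p ^ n = (x n + y n) mod int p ^ n" for n
      using xy by (simp add: padic_int_def) (metis mod_add_eq)
    then show "x \<oplus>\<^bsub>padic_int p\<^esub> y \<in> carrier (padic_int p)"
      using assms by (simp add: padic_int_def mod_mod_power_Suc)
  next
    fix x y z
    show "x \<oplus>\<^bsub>padic_int p\<^esub> y \<oplus>\<^bsub>padic_int p\<^esub> z = x \<oplus>\<^bsub>padic_int p\<^esub> (y \<oplus>\<^bsub>padic_int p\<^esub> z)"
      by (simp add: padic_int_def mod_add_left_eq mod_add_right_eq add.assoc)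
  next
    fix x assume x: "x \<in> carrier (padic_int p)"
    have "(- x (Suc n)) mod int p ^ n = (- x n) mod int p ^ n" for n
      using x by (simp add: padic_int_def) (metis mod_minus_eq)
    then have "(\<lambda>n. (- x n) mod int p ^ n) \<in> carrier (padic_int p)"
      using assms by (simp add: padic_int_def mod_mod_power_Suc)
    moreover have "(\<lambda>n. (- x n) mod int p ^ n) \<oplus>\<^bsub>padic_int p\<^esub> x = \<zero>\<^bsub>padic_int p\<^esub>"
      by (simp add: padic_int_def mod_add_left_eq)
    ultimately show "\<exists>y\<in>carrier (padic_int p). y \<oplus>\<^bsub>padic_int p\<^esub> x = \<zero>\<^bsub>padic_int p\<^esub>"
      by blast
  qed (use assms in \<open>auto simp: padic_int_def add.commute\<close>)
next
  show "Group.comm_monoid (padic_int p)"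
  proof (rule Group.comm_monoidI)
    fix x y assume xy: "x \<in> carrier (padic_int p)" "y \<in> carrier (padic_int p)"
    have "(x (Suc n) * y (Suc n)) mod int p ^ n = (x n * y n) mod int p ^ n" for n
      using xy by (simp add: padic_int_def) (metis mod_mult_eq)
    then show "x \<otimes>\<^bsub>padic_int p\<^esub> y \<in> carrier (padic_int p)"
      using assms by (simp add: padic_int_def mod_mod_power_Suc)
  next
    fix x y z
    show "x \<otimes>\<^bsub>padic_int p\<^esub> y \<otimes>\<^bsub>padic_int p\<^esub> z = x \<otimes>\<^bsub>padic_int p\<^esub> (y \<otimes>\<^bsub>padic_int p\<^esub> z)"
      by (simp add: padic_int_def mod_mult_left_eq mod_mult_right_eq mult.assoc)
  qed (use assms in \<open>auto simp: padic_int_def mult.commute mod_mod_power_Suc mod_mult_left_eq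
      mod_mult_right_eq\<close>)
next
  fix x y z
  show "(x \<oplus>\<^bsub>padic_int p\<^esub> y) \<otimes>\<^bsub>padic_int p\<^esub> z = x \<otimes>\<^bsub>padic_int p\<^esub> z \<oplus>\<^bsub>padic_int p\<^esub> y \<otimes>\<^bsub>padic_int p\<^esub> z"
    by (simp add: padic_int_def mod_mult_left_eq mod_add_eq distrib_right)
qed

lemma padic_add_pow:
  assumes "p > 0" and "x \<in> carrier (padic_int p)"
  shows "[k] \<cdot>\<^bsub>padic_int p\<^esub> x = (\<lambda>n. (int k * x n) mod int p ^ n)"
proof -
  interpret cring "padic_int p" using assms(1) by (rule cring_padic_int)
  show ?thesis
  proof (induction k)
    case 0
    have "[(0::nat)] \<cdot>\<^bsub>padic_int p\<^esub> x = \<zero>\<^bsub>padic_int p\<^esub>" by simp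
    then show ?case by (simp add: padic_int_def)
  next
    case (Suc k)
    have "[(Suc k)] \<cdot>\<^bsub>padic_int p\<^esub> x = [k] \<cdot>\<^bsub>padic_int p\<^esub> x \<oplus>\<^bsub>padic_int p\<^esub> x" by simp
    also have "\<dots> = (\<lambda>n. (int (Suc k) * x n) mod int p ^ n)"
      unfolding Suc.IH by (simp add: padic_int_def mod_add_left_eq mod_add_right_eq distrib_right add.commute)
    finally show ?case .
  qed
qed

section \<open>Path sets and p-adic path set fractals\<close>

text \<open>
  A labeled graph is a finite digraph \<open>G\<close> (loops and parallel arcs allowed) together with a
  labeling \<open>lab\<close> of its arcs.
\<close>

definition path_set :: "('v, 'e) pre_digraph \<Rightarrow> ('e \<Rightarrow> 'a) \<Rightarrow> 'v \<Rightarrow> (nat \<Rightarrow> 'a) set" where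
  "path_set G lab v =
    {a. \<exists>e. (\<forall>k. e k \<in> arcs G) \<and> tail G (e 0) = v \<and>
            (\<forall>k. tail G (e (Suc k)) = head G (e k)) \<and> (\<forall>k. a k = lab (e k))}"

text \<open>
  The value of the series is the limit of its partial sums in \<open>\<int>\<^sub>p\<close>; \<open>digit_map_eq\<close> below gives its
  residues.  The constant \<open>lim\<close> is unavailable, as the library has no Hausdorff class instance for
  \<^typ>\<open>nat \<Rightarrow> int\<close>.
\<close>

definition digit_map :: "nat \<Rightarrow> ('a \<Rightarrow> nat) \<Rightarrow> (nat \<Rightarrow> 'a) \<Rightarrow> (nat \<Rightarrow> int)" where
  "digit_map p f a =
    (THE s. (\<lambda>N. \<Oplus>\<^bsub>padic_int p\<^esub>k\<in>{..<N}. [(f (a k) * p ^ k)] \<cdot>\<^bsub>padic_int p\<^esub> \<one>\<^bsub>padic_int p\<^esub>)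
       \<longlonglongrightarrow> s)"

definition presentation ::
  "nat \<Rightarrow> 'a set \<Rightarrow> ('a \<Rightarrow> nat) \<Rightarrow> ('v, 'e) pre_digraph \<Rightarrow> ('e \<Rightarrow> 'a) \<Rightarrow> 'v \<Rightarrow> (nat \<Rightarrow> int) set \<Rightarrow> bool"
where
  "presentation p A f G lab v Y \<longleftrightarrow>
    finite A \<and> f ` A \<subseteq> {..<p} \<and>
    fin_digraph G \<and> lab ` arcs G \<subseteq> A \<and> v \<in> verts G \<and>
    Y = digit_map p f ` path_set G lab v"

definition standard_presentation ::
  "nat \<Rightarrow> 'a set \<Rightarrow> ('a \<Rightarrow> nat) \<Rightarrow> ('v, 'e) pre_digraph \<Rightarrow> ('e \<Rightarrow> 'a) \<Rightarrow> 'v \<Rightarrow> (nat \<Rightarrow> int) set \<Rightarrow> bool"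
where
  "standard_presentation p A f G lab v Y \<longleftrightarrow>
    presentation p A f G lab v Y \<and>
    inj_on f A \<and>
    (\<forall>w\<in>verts G. inj_on lab (out_arcs G w)) \<and>
    (\<forall>w\<in>verts G. v \<rightarrow>\<^sup>*\<^bsub>G\<^esub> w)"

text \<open>
  Alphabets, vertices and arcs are taken to be natural numbers in the following definition, as
  HOL cannot quantify existentially over types.  This is no restriction, by the lemma
  \<open>presentation_imp_path_set_fractal\<close> below.  No condition excludes an empty path set (there
  may be no infinite walk from the marked vertex), so the empty set is a member.
\<close>

definition path_set_fractals :: "nat \<Rightarrow> (nat \<Rightarrow> int) set set" where
  "path_set_fractals p =
    {Y. \<exists>(A :: nat set) f (G :: (nat, nat) pre_digraph) lab v. presentation p A f G lab v Y}"

section \<open>Restricted p-adic graph-directed constructions\<close>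

definition construction_data :: "nat \<Rightarrow> (nat, 'e) pre_digraph \<Rightarrow> ('e \<Rightarrow> nat) \<Rightarrow> bool" where
  "construction_data p G lab \<longleftrightarrow>
    fin_digraph G \<and> (\<exists>n. verts G = {1..n}) \<and> lab ` arcs G \<subseteq> {..<p} \<and>
    inj_on (\<lambda>e. (tail G e, head G e, lab e)) (arcs G) \<and>
    (\<forall>i\<in>verts G. out_arcs G i \<noteq> {})"

definition edge_map :: "nat \<Rightarrow> nat \<Rightarrow> (nat \<Rightarrow> int) \<Rightarrow> (nat \<Rightarrow> int)" where
  "edge_map p j y =
    [p] \<cdot>\<^bsub>padic_int p\<^esub> y \<oplus>\<^bsub>padic_int p\<^esub> [j] \<cdot>\<^bsub>padic_int p\<^esub> \<one>\<^bsub>padic_int p\<^esub>"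

definition sub_object_system ::
  "nat \<Rightarrow> (nat, 'e) pre_digraph \<Rightarrow> ('e \<Rightarrow> nat) \<Rightarrow> (nat \<Rightarrow> (nat \<Rightarrow> int) set) \<Rightarrow> bool" where
  "sub_object_system p G lab K \<longleftrightarrow>
    (\<forall>i\<in>verts G. K i \<subseteq> carrier (padic_int p) \<and> K i \<noteq> {} \<and> compact (K i) \<and>
       K i = (\<Union>e\<in>out_arcs G i. edge_map p (lab e) ` K (head G e)))"

text \<open>
  Membership in \<^term>\<open>extensional (verts G)\<close> only fixes the irrelevant values outside the
  vertex set, so that a unique family can be selected.
\<close>

definition sub_object ::
  "nat \<Rightarrow> (nat, 'e) pre_digraph \<Rightarrow> ('e \<Rightarrow> nat) \<Rightarrow> nat \<Rightarrow> (nat \<Rightarrow> int) set" where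
  "sub_object p G lab = (THE K. K \<in> extensional (verts G) \<and> sub_object_system p G lab K)"

definition graph_directed_fractals :: "nat \<Rightarrow> (nat \<Rightarrow> int) set set" where
  "graph_directed_fractals p =
    {Y. \<exists>(G :: (nat, nat) pre_digraph) lab v.
          construction_data p G lab \<and> v \<in> verts G \<and> Y = sub_object p G lab v}"

section \<open>Adequacy of the definitions\<close>

lemma edge_map_eq:
  assumes "p > 0" "y \<in> carrier (padic_int p)"
  shows "edge_map p j y = (\<lambda>n. (int p * y n + int j) mod int p ^ n)"
proof -
  interpret cring "padic_int p" using assms(1) by (rule cring_padic_int)
  show ?thesis
    using padic_add_pow[OF assms, of p] padic_add_pow[OF assms(1) one_closed, of j]
    by (simp add: edge_map_def) (simp add: padic_int_def mod_mult_right_eq mod_add_eq)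
qed

lemma digit_map_partial_sum:
  fixes d :: "nat \<Rightarrow> nat" and N :: nat
  assumes "p > 0"
  shows "(\<Oplus>\<^bsub>padic_int p\<^esub>k\<in>{..<N}. [(d k)] \<cdot>\<^bsub>padic_int p\<^esub> \<one>\<^bsub>padic_int p\<^esub>)
    = (\<lambda>n. (\<Sum>k<N. int (d k)) mod int p ^ n)"
proof -
  interpret cring "padic_int p" using assms(1) by (rule cring_padic_int)
  have d: "[k] \<cdot>\<^bsub>padic_int p\<^esub> \<one>\<^bsub>padic_int p\<^esub> = (\<lambda>n. int k mod int p ^ n)" for k
    using padic_add_pow[OF assms one_closed, of k]
    by simp (simp add: padic_int_def mod_mult_right_eq)
  show ?thesis
  proof (induction N)
    case 0
    have "\<zero>\<^bsub>padic_int p\<^esub> = (\<lambda>n. 0)" by (simp add: padic_int_def)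
    then show ?case by simp
  next
    case (Suc N)
    have "(\<Oplus>\<^bsub>padic_int p\<^esub>k\<in>{..<Suc N}. [(d k)] \<cdot>\<^bsub>padic_int p\<^esub> \<one>\<^bsub>padic_int p\<^esub>)
      = [(d N)] \<cdot>\<^bsub>padic_int p\<^esub> \<one>\<^bsub>padic_int p\<^esub> \<oplus>\<^bsub>padic_int p\<^esub>
        (\<Oplus>\<^bsub>padic_int p\<^esub>k\<in>{..<N}. [(d k)] \<cdot>\<^bsub>padic_int p\<^esub> \<one>\<^bsub>padic_int p\<^esub>)"
      unfolding lessThan_Suc by (rule finsum_insert) auto
    also have "\<dots> = (\<lambda>n. (\<Sum>k<Suc N. int (d k)) mod int p ^ n)"
      unfolding Suc.IH unfolding d by (simp add: padic_int_def mod_add_eq add.commute)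
    finally show ?case .
  qed
qed

lemma LIMSEQ_unique_fun:
  fixes X :: "nat \<Rightarrow> nat \<Rightarrow> int"
  assumes "X \<longlonglongrightarrow> s" "X \<longlonglongrightarrow> t"
  shows "s = t"
proof
  fix n
  have "(\<lambda>N. X N n) \<longlonglongrightarrow> s n" "(\<lambda>N. X N n) \<longlonglongrightarrow> t n"
    using assms by (simp_all add: limitin_componentwise flip: limitin_canonical_iff euclidean_product_topology)
  then show "s n = t n" by (rule LIMSEQ_unique)
qed

lemma digit_map_LIMSEQ:
  assumes "p > 0"
  shows "(\<lambda>N. \<Oplus>\<^bsub>padic_int p\<^esub>k\<in>{..<N}. [(f (a k) * p ^ k)] \<cdot>\<^bsub>padic_int p\<^esub> \<one>\<^bsub>padic_int p\<^esub>)
    \<longlonglongrightarrow> (\<lambda>n. (\<Sum>k<n. int (f (a k)) * int p ^ k) mod int p ^ n)"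
proof -
  have eq: "(\<Sum>k<n. int (f (a k)) * int p ^ k) mod int p ^ n
      = (\<Sum>k<N. int (f (a k)) * int p ^ k) mod int p ^ n" if "n \<le> N" for n N
  proof -
    have "(\<Sum>k<n + d. int (f (a k)) * int p ^ k) mod int p ^ n
      = (\<Sum>k<n. int (f (a k)) * int p ^ k) mod int p ^ n" for d
    proof (induction d)
      case (Suc d)
      have "(s + int (f (a (n + d))) * int p ^ (n + d)) mod int p ^ n = s mod int p ^ n" for s
        by (simp add: power_add mult.left_commute)
      then show ?case using Suc.IH by simp
    qed simp
    from this[of "N - n"] that show ?thesis by simp
  qed
  have "\<exists>N0. \<forall>N\<ge>N0. (\<Sum>k<N. int (f (a k)) * int p ^ k) mod int p ^ n
      = (\<Sum>k<n. int (f (a k)) * int p ^ k) mod int p ^ n" for n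
    using eq by metis
  then have "limitin (product_topology (\<lambda>_. euclidean) UNIV)
      (\<lambda>N n. (\<Sum>k<N. int (f (a k)) * int p ^ k) mod int p ^ n)
      (\<lambda>n. (\<Sum>k<n. int (f (a k)) * int p ^ k) mod int p ^ n) sequentially"
    by (auto simp: limitin_componentwise tendsto_discrete eventually_sequentially)
  then show ?thesis
    unfolding digit_map_partial_sum[OF assms]
    by (simp add: digit_map_partial_sum euclidean_product_topology)
qed

lemma digit_map_eq:
  assumes "p > 0"
  shows "digit_map p f a = (\<lambda>n. (\<Sum>k<n. int (f (a k)) * int p ^ k) mod int p ^ n)"
  unfolding digit_map_def
  by (rule the_equality, rule digit_map_LIMSEQ[OF assms],
      rule LIMSEQ_unique_fun[OF _ digit_map_LIMSEQ[OF assms]])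

lemma presentation_imp_path_set_fractal:
  fixes A :: "'a set" and G :: "('v, 'e) pre_digraph"
  assumes "presentation p A f G lab v Y"
  shows "Y \<in> path_set_fractals p"
proof -
  have fin: "finite A" and G: "fin_digraph G" and v: "v \<in> verts G"
    and lab: "\<And>e. e \<in> arcs G \<Longrightarrow> lab e \<in> A"
    and f: "f ` A \<subseteq> {..<p}" and Y: "Y = digit_map p f ` path_set G lab v"
    using assms by (auto simp: presentation_def)
  interpret fin_digraph G by (rule G)
  define ga gv ge where "ga = to_nat_on A" and "gv = to_nat_on (verts G)"
    and "ge = to_nat_on (arcs G)"
  have inj: "inj_on ga A" "inj_on gv (verts G)" "inj_on ge (arcs G)"
    unfolding ga_def gv_def ge_def
    using fin by (auto intro!: inj_on_to_nat_on countable_finite)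
  define he where "he = inv_into (arcs G) ge"
  define ha where "ha = inv_into A ga"
  have he: "he (ge e) = e" if "e \<in> arcs G" for e
    using that inj unfolding he_def by simp
  have ha: "ha (ga x) = x" if "x \<in> A" for x
    using that inj unfolding ha_def by simp
  define G' where "G' = \<lparr>verts = gv ` verts G, arcs = ge ` arcs G,
    tail = (\<lambda>n. gv (tail G (he n))), head = (\<lambda>n. gv (head G (he n)))\<rparr>"
  define lab' where "lab' n = ga (lab (he n))" for n
  have G': "fin_digraph G'"
    by unfold_locales (auto simp: G'_def he)
  have path: "path_set G' lab' (gv v) = (\<lambda>a. ga \<circ> a) ` path_set G lab v" (is "?L = ?R")
  proof (intro equalityI subsetI)
    fix b assume "b \<in> ?L"
    then obtain e where e: "\<And>k. e k \<in> ge ` arcs G" "gv (tail G (he (e 0))) = gv v"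
      "\<And>k. gv (tail G (he (e (Suc k)))) = gv (head G (he (e k)))" "\<And>k. b k = ga (lab (he (e k)))"
      by (auto simp: path_set_def G'_def lab'_def)
    have arc: "he (e k) \<in> arcs G" for k using e(1)[of k] he by auto
    have "tail G (he (e 0)) = v" "tail G (he (e (Suc k))) = head G (he (e k))" for k
      using arc e(2,3) v by (auto intro!: inj_onD[OF inj(2)])
    then have "(\<lambda>k. lab (he (e k))) \<in> path_set G lab v"
      unfolding path_set_def mem_Collect_eq
      using arc by (intro exI[of _ "\<lambda>k. he (e k)"]) auto
    moreover have "b = ga \<circ> (\<lambda>k. lab (he (e k)))" using e(4) by auto
    ultimately show "b \<in> ?R" by blast
  next
    fix b assume "b \<in> ?R"
    then obtain a e where a: "b = ga \<circ> a" and e: "\<And>k. e k \<in> arcs G" "tail G (e 0) = v"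
      "\<And>k. tail G (e (Suc k)) = head G (e k)" "\<And>k. a k = lab (e k)"
      unfolding path_set_def by blast
    then show "b \<in> ?L"
      unfolding path_set_def mem_Collect_eq
      by (intro exI[of _ "\<lambda>k. ge (e k)"]) (simp add: G'_def lab'_def he a)
  qed
  have "digit_map p (f \<circ> ha) (ga \<circ> a) = digit_map p f a" if a: "a \<in> path_set G lab v" for a
  proof -
    have "a k \<in> A" for k using a lab by (auto simp: path_set_def)
    then show ?thesis by (simp add: digit_map_def ha)
  qed
  then have "Y = digit_map p (f \<circ> ha) ` path_set G' lab' (gv v)"
    unfolding Y path image_image by (intro image_cong) auto
  moreover have "(f \<circ> ha) ` ga ` A \<subseteq> {..<p}" using f by (auto simp: ha)
  moreover have "lab' ` arcs G' \<subseteq> ga ` A" by (auto simp: G'_def lab'_def he lab)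
  moreover have "gv v \<in> verts G'" using v by (simp add: G'_def)
  ultimately have "presentation p (ga ` A) (f \<circ> ha) G' lab' (gv v) Y"
    using fin G' by (simp add: presentation_def)
  then show ?thesis unfolding path_set_fractals_def by blast
qed

lemma empty_in_path_set_fractals: "{} \<in> path_set_fractals p"
proof -
  define G :: "(nat, nat) pre_digraph"
    where "G = \<lparr>verts = {0}, arcs = {}, tail = (\<lambda>_. 0), head = (\<lambda>_. 0)\<rparr>"
  have "fin_digraph G" by unfold_locales (auto simp: G_def)
  then have "presentation p {} (\<lambda>_. 0) G id 0 {}"
    by (auto simp: presentation_def path_set_def G_def)
  then show ?thesis by (rule presentation_imp_path_set_fractal)
qed

end

theory Submission
  imports Defs "HOL-Analysis.Analysis"
begin

text \<open>
  Each edge map \<open>y \<mapsto> p y + j\<close> is a contraction of \<open>\<int>\<^sub>p\<close>: it turns agreement modulo \<open>p\<^sup>n\<close> into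
  agreement modulo \<open>p\<^sup>n\<^sup>+\<^sup>1\<close>.  Prepending a digit to a digit sequence has exactly the effect of an
  edge map on the value (\<open>digit_map_shift\<close>), so the value sets of the walks from the various
  vertices satisfy the equations of the sub-objects, and they are compact because the space of
  walks is compact by Tychonoff's theorem (\<open>compact_path_values\<close>).  Conversely any family of
  nonempty compact solutions coincides with these value sets (\<open>sub_object_system_unique\<close>): a point
  of a solution can be unfolded along an infinite walk, whose digits must then be its digits; and
  the value of a walk is approximated to any precision by points of the solution, hence belongs to
  it, since it is closed.  This gives the first part.

  For the second part, a path set fractal is turned into a sub-object by determinization.  With
  a set \<open>S\<close> of vertices of a presentation, associate the union of the value sets of the vertices
  in \<open>S\<close>.  Sorting the edges that leave \<open>S\<close> by their digits \<open>d\<close> expresses this union through the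
  unions for the sets of \<open>d\<close>-successors.  So the unions solve the equations of the subset graph,
  restricted to the subsets which are reachable and have a nonempty union; and the uniqueness
  statement identifies them with the value sets of that graph, which is right-resolving by
  construction.  The usual argument by Koenig's lemma, that a digit sequence whose finite prefixes
  can all be read from \<open>v\<close> is read along a single infinite walk, is thereby absorbed into the
  compactness of the unions.
\<close>

section \<open>Contractions and digit expansions\<close>

lemma padic_residue_bounds:
  assumes "x \<in> carrier (padic_int p)"
  shows "0 \<le> x n" "x n < int p ^ n"
  using assms by (auto simp: padic_int_def)

lemma padic_residue_0:
  assumes "x \<in> carrier (padic_int p)"
  shows "x 0 = 0"
  using padic_residue_bounds[OF assms, of 0] by simp

lemma padic_residue_Suc:
  assumes "x \<in> carrier (padic_int p)"
  shows "x (Suc n) mod int p ^ n = x n"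
  using assms by (auto simp: padic_int_def)

lemma padic_residue_mono:
  assumes "x \<in> carrier (padic_int p)" "y \<in> carrier (padic_int p)" "x n = y n" "m \<le> n"
  shows "x m = y m"
  using assms(4,3)
proof (induction rule: dec_induct)
  case (step n)
  then show ?case
    using padic_residue_Suc[OF assms(1), of n] padic_residue_Suc[OF assms(2), of n] by metis
qed

lemma edge_map_contracting:
  assumes "p > 0" "y \<in> carrier (padic_int p)" "z \<in> carrier (padic_int p)" "y n = z n"
  shows "edge_map p j y (Suc n) = edge_map p j z (Suc n)"
proof -
  have "int p * x (Suc n) mod int p ^ Suc n = int p * x n" if "x \<in> carrier (padic_int p)" for x
    using padic_residue_Suc[OF that, of n] by (simp add: mult_mod_right[symmetric])
  then have "int p * y (Suc n) mod int p ^ Suc n = int p * z (Suc n) mod int p ^ Suc n"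
    using assms by simp
  then show ?thesis
    unfolding edge_map_eq[OF assms(1,2)] edge_map_eq[OF assms(1,3)] by (metis mod_add_left_eq)
qed

lemma digit_map_in_carrier:
  assumes "p > 0"
  shows "digit_map p f a \<in> carrier (padic_int p)"
  using assms by (simp add: digit_map_eq padic_int_def mod_mod_power_Suc mod_mod_cancel)

lemma digit_map_shift:
  assumes "p > 0"
  shows "digit_map p f a = edge_map p (f (a 0)) (digit_map p f (\<lambda>k. a (Suc k)))"
proof
  fix n
  let ?T = "\<Sum>k<n. int (f (a (Suc k))) * int p ^ k"
  have "(\<Sum>k<Suc n. int (f (a k)) * int p ^ k) = int p * ?T + int (f (a 0))"
    by (subst sum.lessThan_Suc_shift) (simp add: sum_distrib_left mult.left_commute)
  moreover have "(\<Sum>k<Suc n. int (f (a k)) * int p ^ k) mod int p ^ n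
      = (\<Sum>k<n. int (f (a k)) * int p ^ k) mod int p ^ n"
    by simp
  ultimately have "digit_map p f a n = (int p * ?T + int (f (a 0))) mod int p ^ n"
    unfolding digit_map_eq[OF assms] by argo
  also have "\<dots> = (int p * (?T mod int p ^ n) + int (f (a 0))) mod int p ^ n"
    by (rule mod_add_cong) (simp_all only: mod_mult_right_eq)
  finally show "digit_map p f a n = edge_map p (f (a 0)) (digit_map p f (\<lambda>k. a (Suc k))) n"
    unfolding edge_map_eq[OF assms digit_map_in_carrier[OF assms]] by (simp only: digit_map_eq[OF assms])
qed

text \<open>Repeated contraction leaves only one possible value for the start of an infinite chain.\<close>

lemma edge_map_chain_eq_digit_map:
  assumes p: "p > 0"
    and y: "\<And>k. y k \<in> carrier (padic_int p)" "\<And>k. y k = edge_map p (f (a k)) (y (Suc k))"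
  shows "y 0 = digit_map p f a"
proof
  fix n
  show "y 0 n = digit_map p f a n"
    using y
  proof (induction n arbitrary: y a)
    case 0
    show ?case
      unfolding padic_residue_0[OF "0.prems"(1)] padic_residue_0[OF digit_map_in_carrier[OF p]] ..
  next
    case (Suc n)
    have "y (Suc 0) n = digit_map p f (\<lambda>k. a (Suc k)) n"
      using Suc.IH[of "\<lambda>k. y (Suc k)" "\<lambda>k. a (Suc k)"] Suc.prems by blast
    then show ?case
      unfolding Suc.prems(2)[of 0] digit_map_shift[OF p, of f a]
      using edge_map_contracting[OF p Suc.prems(1) digit_map_in_carrier[OF p]] by blast
  qed
qed

section \<open>Compactness\<close>

lemma Hausdorff_space_nat_int_fun: "Hausdorff_space (euclidean :: (nat \<Rightarrow> int) topology)"
proof -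
  have "Hausdorff_space (euclidean :: int topology)"
    unfolding Hausdorff_space_def
    by (intro allI impI exI[of _ "{_}"]) (auto simp: disjnt_def open_discrete)
  then show ?thesis
    unfolding euclidean_product_topology[symmetric] Hausdorff_space_product_topology by simp
qed

text \<open>
  A compact set is closed, and agreement modulo growing powers of \<open>p\<close> is convergence.
\<close>

lemma compact_padic_approx:
  assumes "compact K" "K \<subseteq> carrier (padic_int p)" "x \<in> carrier (padic_int p)"
    and approx: "\<And>n. \<exists>y\<in>K. y n = x n"
  shows "x \<in> K"
proof -
  obtain y where y: "\<And>n. y n \<in> K" "\<And>n. y n n = x n"
    using approx by metis
  have "y n m = x m" if "m \<le> n" for m n
    using padic_residue_mono[of "y n" p x n m] y assms(2,3) that by blast
  then have "limitin euclidean y x sequentially"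
    unfolding euclidean_product_topology[symmetric] limitin_componentwise
    by (auto simp: tendsto_discrete eventually_sequentially)
  moreover have "closedin euclidean K"
    using assms(1) by (intro compactin_imp_closedin Hausdorff_space_nat_int_fun) simp
  ultimately show ?thesis
    by (rule limitin_closedin) (simp_all add: y(1))
qed

lemma continuous_on_digit_value:
  "continuous_on UNIV (\<lambda>s n. (\<Sum>k<n. s k * int p ^ k) mod int p ^ n)"
proof (rule continuous_on_coordinatewise_then_product)
  fix n
  have coord: "continuous_on UNIV (\<lambda>s. s k * int p ^ k)" for k
    by (rule continuous_on_compose2[OF Topological_Spaces.continuous_on_discrete[of UNIV "\<lambda>c. c * int p ^ k"]
          continuous_on_product_coordinates]) simp
  have "continuous_on UNIV (\<lambda>s. \<Sum>k<n. s k * int p ^ k)"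
    by (intro continuous_on_sum coord)
  then show "continuous_on UNIV (\<lambda>s. (\<Sum>k<n. s k * int p ^ k) mod int p ^ n)"
    by (rule continuous_on_compose2[OF Topological_Spaces.continuous_on_discrete[of UNIV "\<lambda>c. c mod int p ^ n"]]) simp
qed

text \<open>
  The infinite walks form a closed subset of the product of copies of the finite discrete space of
  arcs, and their values depend continuously on them.
\<close>

lemma compact_path_values:
  fixes G :: "('v, 'e) pre_digraph"
  assumes "fin_digraph G" "p > 0"
  shows "compact (digit_map p f ` path_set G lab v)"
proof -
  interpret fin_digraph G by fact
  define X where "X = product_topology (\<lambda>_::nat. discrete_topology (arcs G)) UNIV"
  have top: "topspace X = {e. \<forall>k. e k \<in> arcs G}"
    by (auto simp: X_def PiE_def extensional_def)
  have proj: "continuous_map X (discrete_topology (arcs G)) (\<lambda>e. e k)" for k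
    unfolding X_def by (rule continuous_map_product_projection) simp
  have coord: "continuous_map X (discrete_topology UNIV) (\<lambda>e. h (e k))" for h :: "'e \<Rightarrow> 'v" and k
    using continuous_map_compose[OF proj[of k], of "discrete_topology UNIV" h] by (simp add: o_def)
  define W where "W = {e \<in> topspace X. tail G (e 0) = v} \<inter>
    (\<Inter>k. {e \<in> topspace X. tail G (e (Suc k)) = head G (e k)})"
  have level: "closedin X {e \<in> topspace X. h (e k) = c}" for h :: "'e \<Rightarrow> 'v" and k c
    using closedin_continuous_map_preimage[OF coord[of h k], of "{c}"] by simp
  have "closedin X {e \<in> topspace X. tail G (e (Suc k)) = head G (e k)}" for k
  proof -
    have "{e \<in> topspace X. tail G (e (Suc k)) = head G (e k)}
        = (\<Union>w\<in>verts G. {e \<in> topspace X. tail G (e (Suc k)) = w} \<inter>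
                         {e \<in> topspace X. head G (e k) = w})"
      by (auto simp: top)
    also have "closedin X \<dots>"
      using level[of "tail G"] level[of "head G"] by (intro closedin_Union) (auto intro: closedin_Int)
    finally show ?thesis .
  qed
  moreover have "closedin X {e \<in> topspace X. tail G (e 0) = v}" by (rule level)
  ultimately have "closedin X W"
    unfolding W_def by (intro closedin_Int closedin_Inter) auto
  moreover have "compact_space X"
    by (simp add: X_def compact_space_product_topology compact_space_discrete_topology)
  ultimately have W: "compactin X W" by (rule closedin_compact_space[rotated])
  have "continuous_map X euclidean (\<lambda>e k. int (f (lab (e k))))"
    unfolding euclidean_product_topology[symmetric] continuous_map_componentwise_UNIV
  proof
    fix k
    show "continuous_map X euclidean (\<lambda>e. int (f (lab (e k))))"
      using continuous_map_compose[OF proj[of k], of euclidean "\<lambda>x. int (f (lab x))"]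
      by (simp add: o_def)
  qed
  then have "continuous_map X euclidean (\<lambda>e. digit_map p f (\<lambda>k. lab (e k)))"
    using continuous_map_compose[of X euclidean _ euclidean
        "\<lambda>s n. (\<Sum>k<n. s k * int p ^ k) mod int p ^ n"] continuous_on_digit_value[of p]
    by (simp add: digit_map_eq[OF \<open>p > 0\<close>] o_def)
  from image_compactin[OF W this]
  have "compact ((\<lambda>e. digit_map p f (\<lambda>k. lab (e k))) ` W)" by simp
  moreover have "path_set G lab v = (\<lambda>e k. lab (e k)) ` W"
    by (auto simp: path_set_def W_def top image_iff fun_eq_iff)
  ultimately show ?thesis by (simp add: image_image)
qed

section \<open>Value sets of walks solve the sub-object equations\<close>

lemma sub_object_systemD:
  assumes "sub_object_system p G lab K" "i \<in> verts G"
  shows "K i \<subseteq> carrier (padic_int p)" "K i \<noteq> {}" "compact (K i)"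
    "K i = (\<Union>e\<in>out_arcs G i. edge_map p (lab e) ` K (head G e))"
  using assms unfolding sub_object_system_def by blast+

lemma path_set_unfold:
  "path_set G lab v
    = (\<Union>e\<in>out_arcs G v. {a. a 0 = lab e \<and> (\<lambda>k. a (Suc k)) \<in> path_set G lab (head G e)})"
    (is "?L = ?R")
proof (intro equalityI subsetI)
  fix a assume "a \<in> ?L"
  then obtain e where e: "\<And>k. e k \<in> arcs G" "tail G (e 0) = v"
      "\<And>k. tail G (e (Suc k)) = head G (e k)" "\<And>k. a k = lab (e k)"
    unfolding path_set_def by blast
  then have "(\<lambda>k. a (Suc k)) \<in> path_set G lab (head G (e 0))"
    unfolding path_set_def mem_Collect_eq by (intro exI[of _ "\<lambda>k. e (Suc k)"]) auto
  moreover have "e 0 \<in> out_arcs G v" using e by simp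
  ultimately show "a \<in> ?R" using e(4) by blast
next
  fix a assume "a \<in> ?R"
  then obtain e0 e where e0: "e0 \<in> out_arcs G v" "a 0 = lab e0"
    and e: "\<And>k. e k \<in> arcs G" "tail G (e 0) = head G e0"
      "\<And>k. tail G (e (Suc k)) = head G (e k)" "\<And>k. a (Suc k) = lab (e k)"
    unfolding path_set_def by blast
  have "case_nat e0 e k \<in> arcs G" "tail G (case_nat e0 e (Suc k)) = head G (case_nat e0 e k)"
    "a k = lab (case_nat e0 e k)" for k
    using e0 e by (auto split: nat.split)
  then show "a \<in> ?L"
    unfolding path_set_def mem_Collect_eq using e0 by (intro exI[of _ "case_nat e0 e"]) auto
qed

lemma path_values_unfold:
  assumes "p > 0"
  shows "digit_map p f ` path_set G lab v
    = (\<Union>e\<in>out_arcs G v. edge_map p (f (lab e)) ` digit_map p f ` path_set G lab (head G e))"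
    (is "?L = ?R")
proof (intro equalityI subsetI)
  fix x assume "x \<in> ?L"
  then obtain a e where "x = digit_map p f a" "e \<in> out_arcs G v" "a 0 = lab e"
    "(\<lambda>k. a (Suc k)) \<in> path_set G lab (head G e)"
    unfolding path_set_unfold[of G lab v] by blast
  moreover from this have "x = edge_map p (f (lab e)) (digit_map p f (\<lambda>k. a (Suc k)))"
    using digit_map_shift[OF assms, of f a] by simp
  ultimately show "x \<in> ?R" by blast
next
  fix x assume "x \<in> ?R"
  then obtain e a where e: "e \<in> out_arcs G v" "a \<in> path_set G lab (head G e)"
    "x = edge_map p (f (lab e)) (digit_map p f a)"
    by blast
  have "x = digit_map p f (case_nat (lab e) a)"
    using e(3) digit_map_shift[OF assms, of f "case_nat (lab e) a"] by simp
  moreover have "case_nat (lab e) a \<in> path_set G lab v"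
    unfolding path_set_unfold[of G lab v] using e by auto
  ultimately show "x \<in> ?L" by blast
qed

lemma path_set_nonempty:
  assumes "wf_digraph G" "\<And>w. w \<in> verts G \<Longrightarrow> out_arcs G w \<noteq> {}" "v \<in> verts G"
  shows "path_set G lab v \<noteq> {}"
proof -
  interpret wf_digraph G by fact
  have "\<exists>e. \<forall>n. (e n \<in> arcs G \<and> (n = 0 \<longrightarrow> tail G (e n) = v)) \<and> tail G (e (Suc n)) = head G (e n)"
  proof (rule dependent_nat_choice)
    show "\<exists>x. x \<in> arcs G \<and> (0 = (0::nat) \<longrightarrow> tail G x = v)"
      using assms(2)[OF assms(3)] by auto
  next
    fix x and n :: nat assume "x \<in> arcs G \<and> (n = 0 \<longrightarrow> tail G x = v)"
    then show "\<exists>y. (y \<in> arcs G \<and> (Suc n = 0 \<longrightarrow> tail G y = v)) \<and> tail G y = head G x"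
      using assms(2)[of "head G x"] by fastforce
  qed
  then obtain e where "\<forall>k. e k \<in> arcs G" "tail G (e 0) = v" "\<forall>k. tail G (e (Suc k)) = head G (e k)"
    by metis
  then have "(\<lambda>k. lab (e k)) \<in> path_set G lab v"
    unfolding path_set_def by blast
  then show ?thesis by blast
qed

lemma path_values_system:
  assumes "construction_data p G lab" "p > 0"
  shows "sub_object_system p G lab (\<lambda>i. digit_map p id ` path_set G lab i)"
proof -
  interpret fin_digraph G using assms by (simp add: construction_data_def)
  have "path_set G lab i \<noteq> {}" if "i \<in> verts G" for i
    using path_set_nonempty[OF wf_digraph_axioms _ that] assms(1)
    by (auto simp: construction_data_def)
  moreover have "digit_map p id ` path_set G lab i
      = (\<Union>e\<in>out_arcs G i. edge_map p (lab e) ` digit_map p id ` path_set G lab (head G e))" for i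
    using path_values_unfold[OF assms(2), of id G lab i] by simp
  ultimately show ?thesis
    unfolding sub_object_system_def
    using compact_path_values[OF fin_digraph_axioms assms(2)] digit_map_in_carrier[OF assms(2)]
    by blast
qed

section \<open>Uniqueness of the sub-objects\<close>

text \<open>
  Every point of a solution lies in the image of an edge map, applied to a point of the solution
  set at the end of that edge; continuing from there yields a walk that spells the point.
\<close>

lemma sub_object_system_subset_path_values:
  assumes wf: "wf_digraph G" and p: "p > 0" and K: "sub_object_system p G lab K"
    and i: "i \<in> verts G"
  shows "K i \<subseteq> digit_map p id ` path_set G lab i"
proof
  interpret wf_digraph G by fact
  have eq: "K w = (\<Union>e\<in>out_arcs G w. edge_map p (lab e) ` K (head G e))" if "w \<in> verts G" for w
    by (rule sub_object_systemD(4)[OF K that])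
  have step: "\<exists>e z. e \<in> arcs G \<and> tail G e = w \<and> z \<in> K (head G e) \<and> y = edge_map p (lab e) z"
    if "y \<in> K w" "w \<in> verts G" for y w
    using that(1) unfolding eq[OF that(2)] by auto
  fix x assume x: "x \<in> K i"
  \<comment> \<open>The state at time \<open>n\<close> is the current point together with the arc taken out of its vertex.\<close>
  let ?P = "\<lambda>n s. fst s \<in> arcs G \<and> snd s \<in> K (tail G (fst s)) \<and>
    (\<exists>z\<in>K (head G (fst s)). snd s = edge_map p (lab (fst s)) z) \<and>
    (n = (0::nat) \<longrightarrow> tail G (fst s) = i \<and> snd s = x)"
  let ?Q = "\<lambda>s s'. tail G (fst s') = head G (fst s) \<and> snd s = edge_map p (lab (fst s)) (snd s')"
  have "\<exists>s. \<forall>n. ?P n (s n) \<and> ?Q (s n) (s (Suc n))"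
  proof (rule dependent_nat_choice)
    obtain e z where "e \<in> arcs G" "tail G e = i" "z \<in> K (head G e)" "x = edge_map p (lab e) z"
      using step[OF x i] by blast
    then show "\<exists>s. ?P 0 s"
      by (intro exI[of _ "(e, x)"]) (use x in auto)
  next
    fix s n assume P: "?P n s"
    then obtain z where z: "z \<in> K (head G (fst s))" "snd s = edge_map p (lab (fst s)) z" by blast
    have "head G (fst s) \<in> verts G" using P by auto
    from step[OF z(1) this] obtain e' z' where "e' \<in> arcs G" "tail G e' = head G (fst s)"
      "z' \<in> K (head G e')" "z = edge_map p (lab e') z'" by blast
    then show "\<exists>s'. ?P (Suc n) s' \<and> ?Q s s'"
      by (intro exI[of _ "(e', z)"]) (use z in auto)
  qed
  then obtain s where s: "\<forall>n. ?P n (s n) \<and> ?Q (s n) (s (Suc n))" by (rule exE)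
  define e y where "e n = fst (s n)" and "y n = snd (s n)" for n
  have e: "e n \<in> arcs G" "tail G (e (Suc n)) = head G (e n)" for n
    using s unfolding e_def by blast+
  have y: "y n \<in> K (tail G (e n))" "y n = edge_map p (id (lab (e n))) (y (Suc n))" for n
    using s unfolding e_def y_def id_apply by blast+
  have start: "tail G (e 0) = i" "y 0 = x"
    using s unfolding e_def y_def by blast+
  have "y n \<in> carrier (padic_int p)" for n
    using sub_object_systemD(1)[OF K tail_in_verts[OF e(1)]] y(1) by blast
  then have "x = digit_map p id (\<lambda>n. lab (e n))"
    using edge_map_chain_eq_digit_map[of p y id "\<lambda>n. lab (e n)"] p y(2) start(2) by metis
  moreover have "(\<lambda>n. lab (e n)) \<in> path_set G lab i"
    unfolding path_set_def using e start by blast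
  ultimately show "x \<in> digit_map p id ` path_set G lab i" by blast
qed

text \<open>
  Following a walk for \<open>n\<close> steps, taking any point of the solution set reached there and pulling
  it back along the edge maps approximates the value of the walk modulo \<open>p\<^sup>n\<close>.
\<close>

lemma path_values_approx_sub_object:
  assumes wf: "wf_digraph G" and p: "p > 0" and K: "sub_object_system p G lab K"
  shows "i \<in> verts G \<Longrightarrow> x \<in> digit_map p id ` path_set G lab i \<Longrightarrow> \<exists>y\<in>K i. y n = x n"
proof (induction n arbitrary: i x)
  case 0
  then obtain y where "y \<in> K i" "y \<in> carrier (padic_int p)"
    using sub_object_systemD(1,2)[OF K "0.prems"(1)] by blast
  moreover have "x \<in> carrier (padic_int p)" using 0 digit_map_in_carrier[OF p] by auto
  ultimately show ?case by (metis padic_residue_0)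
next
  case (Suc n)
  interpret wf_digraph G by fact
  obtain e z where e: "e \<in> out_arcs G i" and z: "z \<in> digit_map p id ` path_set G lab (head G e)"
    and x: "x = edge_map p (lab e) z"
    using Suc.prems(2) unfolding path_values_unfold[OF p, of id G lab i] id_apply[of "lab _"] by blast
  have he: "head G e \<in> verts G" using e by auto
  obtain y where y: "y \<in> K (head G e)" "y n = z n" using Suc.IH[OF he z] by blast
  have "y \<in> carrier (padic_int p)" "z \<in> carrier (padic_int p)"
    using y(1) sub_object_systemD(1)[OF K he] z digit_map_in_carrier[OF p] by auto
  then have "edge_map p (lab e) y (Suc n) = x (Suc n)"
    unfolding x using edge_map_contracting[OF p] y(2) by blast
  moreover have "edge_map p (lab e) y \<in> K i"
    unfolding sub_object_systemD(4)[OF K Suc.prems(1)] using e y(1) by blast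
  ultimately show ?case by blast
qed

lemma sub_object_system_unique:
  assumes "wf_digraph G" "p > 0" "sub_object_system p G lab K" "i \<in> verts G"
  shows "K i = digit_map p id ` path_set G lab i"
proof
  show "K i \<subseteq> digit_map p id ` path_set G lab i"
    using sub_object_system_subset_path_values[OF assms] .
  show "digit_map p id ` path_set G lab i \<subseteq> K i"
  proof
    fix x assume x: "x \<in> digit_map p id ` path_set G lab i"
    show "x \<in> K i"
    proof (rule compact_padic_approx)
      show "compact (K i)" "K i \<subseteq> carrier (padic_int p)"
        using sub_object_systemD[OF assms(3,4)] by blast+
      show "x \<in> carrier (padic_int p)" using x digit_map_in_carrier[OF assms(2)] by auto
      show "\<exists>y\<in>K i. y n = x n" for n
        by (rule path_values_approx_sub_object[OF assms(1-3,4) x])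
    qed
  qed
qed

lemma sub_object_eq_path_values:
  fixes G :: "(nat, 'e) pre_digraph"
  assumes "construction_data p G lab" "p > 0" "v \<in> verts G"
  shows "sub_object p G lab v = digit_map p id ` path_set G lab v"
proof -
  interpret fin_digraph G using assms by (simp add: construction_data_def)
  let ?K = "restrict (\<lambda>i. digit_map p id ` path_set G lab i) (verts G)"
  have "sub_object p G lab = ?K"
    unfolding sub_object_def
  proof (rule the_equality)
    have "sub_object_system p G lab ?K"
      unfolding sub_object_system_def
    proof
      fix i assume i: "i \<in> verts G"
      have "(\<Union>e\<in>out_arcs G i. edge_map p (lab e) ` ?K (head G e))
          = (\<Union>e\<in>out_arcs G i. edge_map p (lab e) ` digit_map p id ` path_set G lab (head G e))"
        by (rule SUP_cong) auto
      with sub_object_systemD[OF path_values_system[OF assms(1,2)] i] i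
      show "?K i \<subseteq> carrier (padic_int p) \<and> ?K i \<noteq> {} \<and> compact (?K i) \<and>
          ?K i = (\<Union>e\<in>out_arcs G i. edge_map p (lab e) ` ?K (head G e))"
        by (simp only: restrict_apply' simp_thms)
    qed
    then show "?K \<in> extensional (verts G) \<and> sub_object_system p G lab ?K" by simp
  next
    fix K assume "K \<in> extensional (verts G) \<and> sub_object_system p G lab K"
    then show "K = ?K"
      using sub_object_system_unique[OF wf_digraph_axioms assms(2)]
      by (intro extensionalityI[of _ "verts G"]) auto
  qed
  then show ?thesis using assms(3) by simp
qed

lemma construction_data_imp_presentation:
  fixes G :: "(nat, 'e) pre_digraph"
  assumes "construction_data p G lab" "v \<in> verts G"
  shows "presentation p {..<p} id G lab v (digit_map p id ` path_set G lab v)"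
  using assms by (simp add: presentation_def construction_data_def)

section \<open>Determinization\<close>

text \<open>
  A finite deterministic system of set equations yields a standard presentation: its graph is the
  transition graph of the states that are reachable through states with nonempty sets.  Dropping
  the states with empty sets does not change the unions, and it ensures that every vertex has an
  exit, since a nonempty union has a nonempty member.  The sets themselves solve the sub-object
  equations of this graph, so they are its value sets.
\<close>

lemma deterministic_system_standard_presentation:
  fixes K :: "'s \<Rightarrow> (nat \<Rightarrow> int) set" and next_st :: "'s \<Rightarrow> nat \<Rightarrow> 's"
  assumes p: "p > 0" and fin: "finite Q" and s0: "s0 \<in> Q" "K s0 \<noteq> {}"
    and closed: "\<And>s d. s \<in> Q \<Longrightarrow> d < p \<Longrightarrow> next_st s d \<in> Q"
    and K: "\<And>s. s \<in> Q \<Longrightarrow> compact (K s)" "\<And>s. s \<in> Q \<Longrightarrow> K s \<subseteq> carrier (padic_int p)"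
    and eq: "\<And>s. s \<in> Q \<Longrightarrow> K s = (\<Union>d<p. edge_map p d ` K (next_st s d))"
  shows "\<exists>(G :: (nat, nat) pre_digraph) lab v.
    standard_presentation p {..<p} id G lab v (K s0) \<and> construction_data p G lab"
proof -
  define R where "R = {(s, t). \<exists>d<p. t = next_st s d \<and> K t \<noteq> {}}\<^sup>* `` {s0}"
  have s0R: "s0 \<in> R" by (simp add: R_def)
  have RQ: "s \<in> Q \<and> K s \<noteq> {}" if "s \<in> R" for s
    using that unfolding R_def Image_singleton mem_Collect_eq
    by (induction rule: rtrancl_induct) (use s0 closed in auto)
  have next_R: "next_st s d \<in> R" if "s \<in> R" "d < p" "K (next_st s d) \<noteq> {}" for s d
    using that unfolding R_def by (auto intro: rtrancl_into_rtrancl)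
  have "finite R" using RQ fin by (meson finite_subset subsetI)
  then obtain st where st: "bij_betw st {1..card R} R"
    using ex_bij_betw_nat_finite_1 by blast
  define num where "num = inv_into {1..card R} st"
  have num: "num s \<in> {1..card R}" "st (num s) = s" if "s \<in> R" for s
    using that st unfolding num_def bij_betw_def by (metis inv_into_into, metis f_inv_into_f)
  have stR: "st i \<in> R" "num (st i) = i" if "i \<in> {1..card R}" for i
    using that st unfolding num_def by (auto simp: bij_betw_def)
  \<comment> \<open>The arc with digit \<open>d\<close> out of the state numbered \<open>i\<close> is the code of the pair \<open>(i, d)\<close>.\<close>
  define src lab :: "nat \<Rightarrow> nat" where "src a = fst (prod_decode a)" and "lab a = snd (prod_decode a)" for a
  define G :: "(nat, nat) pre_digraph" where
    "G = \<lparr>verts = {1..card R},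
          arcs = {a. src a \<in> {1..card R} \<and> lab a < p \<and> K (next_st (st (src a)) (lab a)) \<noteq> {}},
          tail = src, head = (\<lambda>a. num (next_st (st (src a)) (lab a)))\<rparr>"
  have arc_inj: "a = b" if "src a = src b" "lab a = lab b" for a b
    using that unfolding src_def lab_def by (metis prod_decode_inverse prod.expand)
  have arc_code: "src (prod_encode (i, d)) = i" "lab (prod_encode (i, d)) = d" for i d
    by (simp_all add: src_def lab_def)
  have next_arc: "next_st (st (src a)) (lab a) \<in> R" if "a \<in> arcs G" for a
    using that next_R stR by (auto simp: G_def)
  have "arcs G \<subseteq> prod_encode ` ({1..card R} \<times> {..<p})"
  proof
    fix a assume "a \<in> arcs G"
    then have "prod_decode a \<in> {1..card R} \<times> {..<p}"
      by (auto simp: G_def src_def lab_def mem_Times_iff)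
    then show "a \<in> prod_encode ` ({1..card R} \<times> {..<p})"
      by (metis image_eqI prod_decode_inverse)
  qed
  then have "finite (arcs G)" by (rule finite_subset) simp
  then interpret fin_digraph G
    by unfold_locales (use next_arc num in \<open>auto simp: G_def\<close>)
  have arc_of: "\<exists>a\<in>out_arcs G i. lab a = d \<and> head G a = num (next_st (st i) d)"
    if "i \<in> verts G" "d < p" "K (next_st (st i) d) \<noteq> {}" for i d
    using that by (intro bexI[of _ "prod_encode (i, d)"]) (auto simp: G_def arc_code)
  have st_head: "st (head G a) = next_st (st i) (lab a)" if "a \<in> out_arcs G i" for a i
    using that next_arc[of a] num by (auto simp: G_def)
  have sys_eq: "K (st i) = (\<Union>a\<in>out_arcs G i. edge_map p (lab a) ` K (st (head G a)))" (is "_ = ?U")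
    if i: "i \<in> verts G" for i
  proof -
    have Q: "st i \<in> Q" using RQ stR i by (auto simp: G_def)
    have "(\<Union>d<p. edge_map p d ` K (next_st (st i) d)) = ?U"
    proof (intro equalityI subsetI)
      fix x assume "x \<in> (\<Union>d<p. edge_map p d ` K (next_st (st i) d))"
      then obtain d where d: "d < p" "x \<in> edge_map p d ` K (next_st (st i) d)" by blast
      then obtain a where "a \<in> out_arcs G i" "lab a = d" using arc_of[OF i] by blast
      then show "x \<in> ?U" using d st_head by auto
    next
      fix x assume "x \<in> ?U"
      then obtain a where "a \<in> out_arcs G i" "x \<in> edge_map p (lab a) ` K (next_st (st i) (lab a))"
        using st_head by auto
      moreover from this have "lab a < p" by (auto simp: G_def)
      ultimately show "x \<in> (\<Union>d<p. edge_map p d ` K (next_st (st i) d))" by blast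
    qed
    with eq[OF Q] show ?thesis by simp
  qed
  have sys: "sub_object_system p G lab (\<lambda>i. K (st i))"
    unfolding sub_object_system_def
  proof (intro ballI conjI)
    fix i assume i: "i \<in> verts G"
    then have "st i \<in> R" using stR by (simp add: G_def)
    then show "K (st i) \<subseteq> carrier (padic_int p)" "K (st i) \<noteq> {}" "compact (K (st i))"
      using RQ K by auto
    show "K (st i) = (\<Union>a\<in>out_arcs G i. edge_map p (lab a) ` K (st (head G a)))"
      by (rule sys_eq[OF i])
  qed
  have exits: "out_arcs G i \<noteq> {}" if "i \<in> verts G" for i
    using sub_object_systemD(2,4)[OF sys that] by auto
  have v: "num s0 \<in> verts G" using num s0R by (simp add: G_def)
  have "K (st (num s0)) = digit_map p id ` path_set G lab (num s0)"
    by (rule sub_object_system_unique[OF wf_digraph_axioms p sys v])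
  then have Y: "K s0 = digit_map p id ` path_set G lab (num s0)" using num s0R by simp
  have reach: "num s0 \<rightarrow>\<^sup>*\<^bsub>G\<^esub> num s" if "s \<in> R" for s
    using that unfolding R_def Image_singleton mem_Collect_eq
  proof (induction rule: rtrancl_induct)
    case base
    then show ?case using v by simp
  next
    case (step s t)
    then obtain d where d: "d < p" "t = next_st s d" "K t \<noteq> {}" by blast
    have s: "s \<in> R" using step.hyps(1) by (simp add: R_def)
    obtain a where a: "a \<in> out_arcs G (num s)" "head G a = num t"
    proof -
      have "num s \<in> verts G" "K (next_st (st (num s)) d) \<noteq> {}"
        using num[OF s] d by (simp_all add: G_def)
      from arc_of[OF this(1) d(1) this(2)] show thesis
        using that num(2)[OF s] d(2) by auto
    qed
    then have "num s \<rightarrow>\<^bsub>G\<^esub> num t" by (intro dominatesI[of a]) (auto simp: arc_to_ends_def)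
    then show ?case using step.IH reachable_adj_trans by blast
  qed
  have reach_all: "\<forall>w\<in>verts G. num s0 \<rightarrow>\<^sup>*\<^bsub>G\<^esub> w"
  proof
    fix w assume "w \<in> verts G"
    then have "w \<in> {1..card R}" by (simp add: G_def)
    with reach[OF stR(1)] show "num s0 \<rightarrow>\<^sup>*\<^bsub>G\<^esub> w" by (simp only: stR(2))
  qed
  have labp: "lab ` arcs G \<subseteq> {..<p}" by (auto simp: G_def)
  have "inj_on lab (out_arcs G w)" for w
    by (rule inj_onI) (auto simp: G_def intro: arc_inj)
  then have "standard_presentation p {..<p} id G lab (num s0) (K s0)"
    using reach_all labp Y v fin_digraph_axioms by (simp add: standard_presentation_def presentation_def)
  moreover have "construction_data p G lab"
    unfolding construction_data_def
  proof (intro conjI ballI)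
    show "\<exists>n. verts G = {1..n}" by (auto simp: G_def)
    show "inj_on (\<lambda>e. (tail G e, head G e, lab e)) (arcs G)"
      by (rule inj_onI) (auto simp: G_def intro: arc_inj)
  qed (use fin_digraph_axioms labp exits in auto)
  ultimately show ?thesis by blast
qed

text \<open>
  The states of the deterministic system are the sets of vertices; sorting the edges out of a set
  by digits, rather than by labels, also takes care of digit assignments that are not injective.
\<close>

lemma presentation_imp_standard_presentation:
  assumes p: "p > 0" and pres: "presentation p A f G lab v Y" and ne: "Y \<noteq> {}"
  shows "\<exists>(G' :: (nat, nat) pre_digraph) lab' v'.
    standard_presentation p {..<p} id G' lab' v' Y \<and> construction_data p G' lab'"
proof -
  have dig: "f (lab e) < p" if "e \<in> arcs G" for e
    using pres that by (auto simp: presentation_def)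
  have G: "fin_digraph G" and v: "v \<in> verts G" and Y: "Y = digit_map p f ` path_set G lab v"
    using pres by (auto simp: presentation_def)
  interpret fin_digraph G by (rule G)
  let ?W = "\<lambda>w. digit_map p f ` path_set G lab w"
  define K where "K S = (\<Union>w\<in>S. ?W w)" for S
  define succs where "succs S d = head G ` {e \<in> arcs G. tail G e \<in> S \<and> f (lab e) = d}" for S d
  have eq: "K S = (\<Union>d<p. edge_map p d ` K (succs S d))" if "S \<in> Pow (verts G)" for S
  proof -
    have "K S = (\<Union>w\<in>S. \<Union>e\<in>out_arcs G w. edge_map p (f (lab e)) ` ?W (head G e))"
      unfolding K_def by (intro SUP_cong refl path_values_unfold p)
    also have "\<dots> = (\<Union>e\<in>{e \<in> arcs G. tail G e \<in> S}. edge_map p (f (lab e)) ` ?W (head G e))"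
      unfolding out_arcs_def by blast
    also have "\<dots> = (\<Union>d<p. \<Union>e\<in>{e \<in> arcs G. tail G e \<in> S \<and> f (lab e) = d}. edge_map p d ` ?W (head G e))"
      using dig by blast
    also have "\<dots> = (\<Union>d<p. edge_map p d ` K (succs S d))"
      unfolding K_def succs_def by (simp add: image_UN)
    finally show ?thesis .
  qed
  have cpt: "compact (K S)" if "S \<in> Pow (verts G)" for S
    unfolding K_def using that finite_subset[OF _ finite_verts]
    by (intro compact_UN compact_path_values[OF G p]) auto
  have sub: "K S \<subseteq> carrier (padic_int p)" for S
    unfolding K_def using digit_map_in_carrier[OF p] by auto
  have closed: "succs S d \<in> Pow (verts G)" for S d
    unfolding succs_def by auto
  have KY: "K {v} = Y" by (simp add: K_def Y)
  show ?thesis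
    unfolding KY[symmetric]
    by (rule deterministic_system_standard_presentation[where K = K, OF p _ _ _ closed cpt sub eq])
      (use v ne KY in simp_all)
qed

section \<open>Equality of the two classes\<close>

theorem theorem2p10:
  fixes p :: nat
  assumes "prime p"
  shows
    "graph_directed_fractals p = path_set_fractals p - {{}} \<and>
     (\<forall>(G :: (nat, 'e) pre_digraph) lab v Y.
        construction_data p G lab \<longrightarrow> v \<in> verts G \<longrightarrow>
        Y = digit_map p id ` path_set G lab v \<longrightarrow>
          presentation p {..<p} id G lab v Y \<and> Y = sub_object p G lab v) \<and>
     graph_directed_fractals p \<subseteq> path_set_fractals p \<and>
     (\<forall>Y \<in> path_set_fractals p - {{}}.
        \<exists>(G :: (nat, nat) pre_digraph) lab v.
          standard_presentation p {..<p} id G lab v Y \<and>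
          (\<forall>w\<in>verts G. out_arcs G w \<noteq> {}) \<and>
          construction_data p G lab \<and> Y = sub_object p G lab v) \<and>
     path_set_fractals p - {{}} \<subseteq> graph_directed_fractals p"
proof -
  have p: "p > 0" using assms by (rule prime_gt_0_nat)
  have part2: "\<exists>(G :: (nat, nat) pre_digraph) lab v. standard_presentation p {..<p} id G lab v Y \<and>
      (\<forall>w\<in>verts G. out_arcs G w \<noteq> {}) \<and> construction_data p G lab \<and> Y = sub_object p G lab v"
    if Y: "Y \<in> path_set_fractals p - {{}}" for Y
  proof -
    obtain A :: "nat set" and f and H :: "(nat, nat) pre_digraph" and l w where
      A: "presentation p A f H l w Y"
      using Y unfolding path_set_fractals_def by blast
    obtain G :: "(nat, nat) pre_digraph" and lab v where
      G: "standard_presentation p {..<p} id G lab v Y" "construction_data p G lab"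
      using presentation_imp_standard_presentation[OF p A] Y by blast
    then have "v \<in> verts G" "Y = digit_map p id ` path_set G lab v"
      by (auto simp: standard_presentation_def presentation_def)
    then have "Y = sub_object p G lab v" using sub_object_eq_path_values[OF G(2) p] by simp
    moreover have "\<forall>w\<in>verts G. out_arcs G w \<noteq> {}" using G(2) by (simp add: construction_data_def)
    ultimately show ?thesis using G by blast
  qed
  have sub1: "Y \<in> path_set_fractals p - {{}}" if Y: "Y \<in> graph_directed_fractals p" for Y
  proof -
    obtain G :: "(nat, nat) pre_digraph" and lab v where
      G: "construction_data p G lab" "v \<in> verts G" "Y = sub_object p G lab v"
      using Y unfolding graph_directed_fractals_def by blast
    have "Y \<in> path_set_fractals p"
      unfolding G(3) sub_object_eq_path_values[OF G(1) p G(2)]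
      by (rule presentation_imp_path_set_fractal[OF construction_data_imp_presentation[OF G(1,2)]])
    moreover have "Y \<noteq> {}"
      using sub_object_systemD(2)[OF path_values_system[OF G(1) p] G(2)]
      unfolding G(3) sub_object_eq_path_values[OF G(1) p G(2)] .
    ultimately show ?thesis by blast
  qed
  have sub2: "Y \<in> graph_directed_fractals p" if "Y \<in> path_set_fractals p - {{}}" for Y
    using part2[OF that] unfolding graph_directed_fractals_def
      standard_presentation_def presentation_def by blast
  show ?thesis
  proof (intro conjI allI impI)
    fix G :: "(nat, 'e) pre_digraph" and lab v Y
    assume G: "construction_data p G lab" "v \<in> verts G" and Y: "Y = digit_map p id ` path_set G lab v"
    show "presentation p {..<p} id G lab v Y"
      unfolding Y by (rule construction_data_imp_presentation[OF G])
    show "Y = sub_object p G lab v"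
      unfolding Y by (rule sub_object_eq_path_values[OF G(1) p G(2), symmetric])
  qed (use sub1 sub2 part2 in blast)+
qed

end
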